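(* Let $d\ge 1$ be an integer and let $\pi:T^d\to(0,\infty)$ be a weight that is bounded away from zero, i.e. $\inf_{\alpha\in T^d}\pi(\alpha)>0$. Then the following hold. (1) If $\mu\ge 0$ is a Borel measure on $(\partial T)^d$ with finite energy $\mathcal{E}_\pi[\mu]<\infty$, then $\mu\big(\{\omega\in(\partial T)^d:\ \omega_j=\zeta\}\big)=0$ for every $1\le j\le d$ and every $\zeta\in\partial T$. (2) Assume in addition that $\pi$ is a product weight, $\pi(\beta)=\prod_{j=1}^d\pi_j(\beta_j)$ with $\pi_j:T\to(0,\infty)$. Let $E\subset\overline{T}^d$ be a Borel set and, for $1\le j\le d$, let $E_j\subset\overline{T}$ be its $j$-th coordinate projection, $E_j=\{\alpha_j:\ \alpha=(\alpha_1,\dots,\alpha_d)\in E\}$. Then $$\mathrm{Cap}_\pi E\le\prod_{j=1}^d\mathrm{Cap}_{\pi_j}E_j,$$ where $\mathrm{Cap}_{\pi_j}$ is the capacity on $\overline{T}$ (the case $d=1$) with weight $\pi_j$. If $E$ is a product set, $E=E_1\times\dots\times E_d$, then equality holds. (3) Let $E\subset\overline{T}^d$ be a Borel set and let $\mu\ge0$ be a Borel measure on $\overline{T}^d$ such that $\mathcal{E}_\pi[\mu]<\infty$ and $\mathbb{V}^\mu_\pi\le 1$ q.a.e. on $E$. Then $\mathrm{Cap}_\pi E\ge\mu(E)$. (4) Let $E\subset\overline{T}^d$ be a Borel set and let $\mu\ge0$ be a Borel measure on $\overline{T}^d$ of finite mass such that $\mu(E)\ge\mathcal{E}_\pi[\mu]$.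 Then $\mathrm{Cap}_\pi E\ge\mu(E)$.
   Context: $T$ denotes the (vertex set of the) rooted infinite binary tree with root $o$, in which every vertex has exactly two children. $\partial T$ is the set of infinite descending paths starting at $o$, and $\overline{T}=T\cup\partial T$. For $\alpha,\beta\in T$ write $\alpha\le\beta$ if $\beta$ lies on the geodesic from $o$ to $\alpha$ (so $\beta$ is an ancestor of $\alpha$ or $\beta=\alpha$, and $o$ is the largest element); for $\omega\in\partial T$, $\omega\le\alpha$ means that $\alpha$ is a vertex on the path $\omega$, or $\alpha=\omega$. For $\alpha,\beta\in\overline{T}$, $\alpha\wedge\beta$ is their least common ancestor (with $\alpha\wedge\alpha=\alpha$), and $d_T(\alpha)$ is the number of vertices $\gamma\in T$ with $\gamma\ge\alpha$ (so $d_T(o)=1$, and $d_T(\omega)=\infty$ for $\omega\in\partial T$). $T^d$, $(\partial T)^d$ and $\overline{T}^d$ are the $d$-fold Cartesian products of $T$, $\partial T$ and $\overline{T}$. The order on $\overline{T}^d$ is coordinatewise: $\alpha\le\beta$ iff $\alpha_j\le\beta_j$ for all $j$. For $\beta\in\overline{T}^d$, $\mathcal{S}(\beta)=\{\alpha\in\overline{T}^d:\alpha\le\beta\}$. $\overline{T}^d$ carries the topology (and Borel sets) of the metric $\delta(\alpha,\beta)=\sum_{j=1}^d\big(2^{-d_T(\alpha_j\wedge\beta_j)}-\tfrac12(2^{-d_T(\alpha_j)}+2^{-d_T(\beta_j)})\big)$, where $2^{-\infty}=0$. Given a weight $\pi:T^d\to(0,\infty)$ (viewed as a measure on $T^d$),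 for $f:T^d\to[0,\infty)$ put $(\mathbb{I}f)(\alpha)=\sum_{\gamma\in T^d,\gamma\ge\alpha}f(\gamma)\pi(\gamma)$, $\alpha\in\overline{T}^d$; for a Borel measure $\mu\ge0$ on $\overline{T}^d$ put $(\mathbb{I}^*\mu)(\beta)=\mu(\mathcal{S}(\beta))$, $\beta\in T^d$. The potential of $\mu$ is $\mathbb{V}^\mu_\pi=\mathbb{I}(\mathbb{I}^*\mu)$, its energy is $\mathcal{E}_\pi[\mu]=\sum_{\alpha\in T^d}(\mathbb{I}^*\mu)(\alpha)^2\pi(\alpha)=\int\mathbb{V}_\pi^\mu\,d\mu$, and the capacity of $E\subset\overline{T}^d$ is $$\mathrm{Cap}_\pi E=\inf\Big\{\sum_{\alpha\in T^d}f(\alpha)^2\pi(\alpha):\ f\ge0,\ (\mathbb{I}f)(\alpha)\ge1\ \text{for all }\alpha\in E\Big\}.$$ A property holds q.a.e. on $E$ if it holds on $E$ outside a set of $\mathrm{Cap}_\pi$-capacity zero. A measure on $(\partial T)^d$ is regarded as a measure on $\overline{T}^d$. *)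

theory Defs
  imports "HOL-Analysis.Analysis" "HOL-Library.Sublist" "HOL-Library.Extended_Nat"
begin

section \<open>The closed binary tree\<close>

text \<open>A vertex of the infinite binary tree is the finite list of left/right choices on the path
  leading to it from the root \<open>[]\<close>; a boundary point is an infinite sequence of choices.\<close>

type_synonym vertex = "bool list"

datatype ctree = Vertex vertex | End "nat \<Rightarrow> bool"

text \<open>\<open>x \<le> y\<close> means that \<open>y\<close> is an ancestor of (or equal to) \<open>x\<close>, so the root is the largest
  element. The order on \<open>'d \<Rightarrow> ctree\<close> is then the library's pointwise one.\<close>

instantiation ctree :: order
begin

fun less_eq_ctree :: "ctree \<Rightarrow> ctree \<Rightarrow> bool" where
  "Vertex a \<le> Vertex b \<longleftrightarrow> prefix b a"
| "End w \<le> Vertex b \<longleftrightarrow> (\<forall>i<length b. b ! i = w i)"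
| "End w \<le> End w' \<longleftrightarrow> w = w'"
| "Vertex a \<le> End w \<longleftrightarrow> False"

definition less_ctree :: "ctree \<Rightarrow> ctree \<Rightarrow> bool" where
  "x < y \<longleftrightarrow> x \<le> y \<and> \<not> y \<le> (x :: ctree)"

instance
proof
  fix x y z :: ctree
  show "x < y \<longleftrightarrow> x \<le> y \<and> \<not> y \<le> x" by (rule less_ctree_def)
  show "x \<le> x" by (cases x) auto
  show "x \<le> z" if le: "x \<le> y" "y \<le> z"
  proof (cases y)
    case (Vertex b)
    then obtain c where c: "z = Vertex c" "prefix c b" using le by (cases z) auto
    show ?thesis
    proof (cases x)
      case (End w)
      have "c ! i = w i" if "i < length c" for i
      proof -
        have "i < length b" "c ! i = b ! i"
          using that c(2) by (auto simp: prefix_def nth_append)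
        then show ?thesis using \<open>x \<le> y\<close> End Vertex by simp
      qed
      then show ?thesis using c End by simp
    qed (use le Vertex c in auto)
  next
    case (End w)
    then show ?thesis using le by (cases x) auto
  qed
  show "x = y" if "x \<le> y" "y \<le> x"
    using that by (cases x; cases y) auto
qed

end

definition lca :: "ctree \<Rightarrow> ctree \<Rightarrow> ctree" where
  "lca x y = (LEAST z. x \<le> z \<and> y \<le> z)"

text \<open>\<open>tree_depth\<close> is the number \<open>d\<^sub>T\<close> of vertices on the path from the root, so the root has
  depth 1, and \<open>pow_half\<close> is \<open>n \<mapsto> 2\<close> to the power \<open>-n\<close>, vanishing at \<open>\<infinity>\<close>.\<close>

definition tree_depth :: "ctree \<Rightarrow> enat" where
  "tree_depth x = (if finite {v. x \<le> Vertex v} then enat (card {v. x \<le> Vertex v}) else \<infinity>)"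

definition pow_half :: "enat \<Rightarrow> real" where
  "pow_half n = (case n of enat k \<Rightarrow> (1 / 2) ^ k | \<infinity> \<Rightarrow> 0)"

section \<open>The closed polytree\<close>

text \<open>The \<open>d\<close>-fold powers of the tree and of its closure are \<open>'d \<Rightarrow> vertex\<close> and \<open>'d \<Rightarrow> ctree\<close> for a
  finite index type \<open>'d\<close> with \<open>d\<close> elements.\<close>

definition emb :: "('d \<Rightarrow> vertex) \<Rightarrow> ('d \<Rightarrow> ctree)" where
  "emb \<gamma> = (\<lambda>j. Vertex (\<gamma> j))"

definition bdry :: "('d \<Rightarrow> ctree) set" where
  "bdry = {\<omega>. \<forall>j. \<omega> j \<in> range End}"

definition polytree_dist :: "('d::finite \<Rightarrow> ctree) \<Rightarrow> ('d \<Rightarrow> ctree) \<Rightarrow> real" where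
  "polytree_dist \<alpha> \<beta> = (\<Sum>j\<in>UNIV. pow_half (tree_depth (lca (\<alpha> j) (\<beta> j)))
      - (pow_half (tree_depth (\<alpha> j)) + pow_half (tree_depth (\<beta> j))) / 2)"

text \<open>The Borel \<open>\<sigma>\<close>-algebra comes from the metric \<^const>\<open>polytree_dist\<close> (shown below to be one),
  not from the type class topology on functions.\<close>

definition polytree_borel :: "('d::finite \<Rightarrow> ctree) measure" where
  "polytree_borel = sigma UNIV {U. openin (Metric_space.mtopology UNIV polytree_dist) U}"

section \<open>Potentials, energy and capacity\<close>

definition hardy :: "(('d \<Rightarrow> vertex) \<Rightarrow> real) \<Rightarrow> (('d \<Rightarrow> vertex) \<Rightarrow> ennreal) \<Rightarrow> ('d \<Rightarrow> ctree) \<Rightarrow> ennreal"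
  where "hardy \<pi> f \<alpha> = (\<integral>\<^sup>+\<gamma>. f \<gamma> * ennreal (\<pi> \<gamma>) \<partial>count_space {\<gamma>. \<alpha> \<le> emb \<gamma>})"

definition hardy_adj :: "('d::finite \<Rightarrow> ctree) measure \<Rightarrow> ('d \<Rightarrow> vertex) \<Rightarrow> ennreal" where
  "hardy_adj \<mu> \<beta> = emeasure \<mu> {\<alpha>. \<alpha> \<le> emb \<beta>}"

definition potential ::
    "(('d::finite \<Rightarrow> vertex) \<Rightarrow> real) \<Rightarrow> ('d \<Rightarrow> ctree) measure \<Rightarrow> ('d \<Rightarrow> ctree) \<Rightarrow> ennreal" where
  "potential \<pi> \<mu> = hardy \<pi> (hardy_adj \<mu>)"

definition energy :: "(('d::finite \<Rightarrow> vertex) \<Rightarrow> real) \<Rightarrow> ('d \<Rightarrow> ctree) measure \<Rightarrow> ennreal" where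
  "energy \<pi> \<mu> = (\<integral>\<^sup>+\<alpha>. (hardy_adj \<mu> \<alpha>)\<^sup>2 * ennreal (\<pi> \<alpha>) \<partial>count_space UNIV)"

text \<open>The infimum is over \<open>[0, \<infinity>)\<close>-valued \<open>f\<close>, hence the constraint \<open>f \<gamma> < \<infinity>\<close> on \<^typ>\<open>ennreal\<close> functions.\<close>

definition capacity :: "(('d \<Rightarrow> vertex) \<Rightarrow> real) \<Rightarrow> ('d \<Rightarrow> ctree) set \<Rightarrow> ennreal" where
  "capacity \<pi> E = (INF f \<in> {f. (\<forall>\<gamma>. f \<gamma> < \<infinity>) \<and> (\<forall>\<alpha>\<in>E. 1 \<le> hardy \<pi> f \<alpha>)}.
      \<integral>\<^sup>+\<alpha>. (f \<alpha>)\<^sup>2 * ennreal (\<pi> \<alpha>) \<partial>count_space UNIV)"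

text \<open>The case \<open>d = 1\<close>, with weights and sets living on the tree itself.\<close>

definition tree_capacity :: "(vertex \<Rightarrow> real) \<Rightarrow> ctree set \<Rightarrow> ennreal" where
  "tree_capacity p A = capacity (\<lambda>\<gamma>::unit \<Rightarrow> vertex. p (\<gamma> ())) {\<alpha>. \<alpha> () \<in> A}"

definition holds_qae ::
    "(('d \<Rightarrow> vertex) \<Rightarrow> real) \<Rightarrow> ('d \<Rightarrow> ctree) set \<Rightarrow> (('d \<Rightarrow> ctree) \<Rightarrow> bool) \<Rightarrow> bool" where
  "holds_qae \<pi> E P \<longleftrightarrow> (\<exists>N. capacity \<pi> N = 0 \<and> (\<forall>\<alpha>\<in>E - N. P \<alpha>))"

section \<open>The distance is a metric\<close>

lemma ancestors_comparable:
  fixes x y z :: ctree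
  assumes "x \<le> y" "x \<le> z"
  shows "y \<le> z \<or> z \<le> y"
proof (cases x)
  case (Vertex a)
  then show ?thesis
    using assms by (cases y; cases z) (auto dest: prefix_same_cases)
next
  case (End w)
  have pre: "prefix b c" if "length b \<le> length c" "\<forall>i<length b. b ! i = w i"
    "\<forall>i<length c. c ! i = w i" for b c
  proof -
    have "b = take (length b) c" by (rule nth_equalityI) (use that in auto)
    then show ?thesis by (metis take_is_prefix)
  qed
  show ?thesis
  proof (cases y; cases z)
    fix b c assume [simp]: "y = Vertex b" "z = Vertex c"
    show ?thesis using assms End pre[of b c] pre[of c b] by (cases "length b \<le> length c") auto
  qed (use assms End in auto)
qed

lemma lca_exists: "\<exists>z::ctree. (x \<le> z \<and> y \<le> z) \<and> (\<forall>u. x \<le> u \<and> y \<le> u \<longrightarrow> z \<le> u)"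
proof (cases "x = y")
  case False
  let ?P = "\<lambda>v. x \<le> Vertex v \<and> y \<le> Vertex v"
  obtain m where m: "\<And>v. ?P v \<Longrightarrow> length v \<le> m"
  proof (cases x; cases y)
    fix w w' assume [simp]: "x = End w" "y = End w'"
    from False obtain i where i: "w i \<noteq> w' i" by auto
    have "length v \<le> i" if "?P v" for v
      using that i by (metis \<open>x = End w\<close> \<open>y = End w'\<close> less_eq_ctree.simps(2) linorder_not_le)
    then show ?thesis by (rule that)
  next
    fix a b assume "x = Vertex a" "y = Vertex b"
    then show ?thesis by (intro that[of "length a"]) (simp add: prefix_length_le)
  next
    fix a w assume "x = Vertex a" "y = End w"
    then show ?thesis by (intro that[of "length a"]) (simp add: prefix_length_le)
  next
    fix a w assume "x = End w" "y = Vertex a"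
    then show ?thesis by (intro that[of "length a"]) (simp add: prefix_length_le)
  qed
  have "?P []" by (cases x; cases y) auto
  then obtain v where v: "?P v" and max: "\<And>u. ?P u \<Longrightarrow> length u \<le> length v"
    using ex_has_greatest_nat[of ?P "[]" length "Suc m"] m by (metis le_imp_less_Suc)
  have "Vertex v \<le> u" if u: "x \<le> u" "y \<le> u" for u
  proof (cases u)
    case (Vertex b)
    from ancestors_comparable[of x "Vertex v" u] v u
    consider "Vertex v \<le> u" | "u \<le> Vertex v" by blast
    then show ?thesis
    proof cases
      case 2
      then have "prefix v b" "length b \<le> length v" using Vertex max[of b] u by auto
      then show ?thesis using Vertex
        by (metis prefix_length_prefix prefix_order.order_refl less_eq_ctree.simps(1))
    qed
  next
    case (End w)
    then have "x = u" "y = u" using u by (cases x; cases y; simp)+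
    then show ?thesis using False by simp
  qed
  then show ?thesis using v by blast
qed auto

lemma lca_props: "x \<le> lca x y" "y \<le> lca x y" "x \<le> u \<Longrightarrow> y \<le> u \<Longrightarrow> lca x y \<le> u"
proof -
  obtain z where z: "x \<le> z \<and> y \<le> z" "\<And>u. x \<le> u \<and> y \<le> u \<Longrightarrow> z \<le> u"
    using lca_exists by metis
  have "lca x y = z" unfolding lca_def using z by (intro Least_equality) auto
  then show "x \<le> lca x y" "y \<le> lca x y" "x \<le> u \<Longrightarrow> y \<le> u \<Longrightarrow> lca x y \<le> u"
    using z by auto
qed

lemma lca_self [simp]: "lca x x = x"
  by (intro antisym lca_props order_refl)

lemma lca_commute: "lca x y = lca y x"
  by (intro antisym lca_props order_refl)

lemma tree_depth_Vertex: "tree_depth (Vertex v) = enat (Suc (length v))"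
proof -
  have "{u. Vertex v \<le> Vertex u} = set (prefixes v)" by auto
  then show ?thesis by (simp add: tree_depth_def distinct_card)
qed

lemma tree_depth_End: "tree_depth (End w) = \<infinity>"
proof -
  have "range (\<lambda>n. map w [0..<n]) \<subseteq> {u. End w \<le> Vertex u}" by auto
  moreover have "infinite (range (\<lambda>n. map w [0..<n]))"
    by (rule range_inj_infinite) (metis (mono_tags, lifting) injI diff_zero length_map length_upt)
  ultimately show ?thesis unfolding tree_depth_def using finite_subset by auto
qed

definition gauge_wt :: "ctree \<Rightarrow> real" where
  "gauge_wt x = pow_half (tree_depth x)"

lemma gauge_wt_simps:
  "gauge_wt (Vertex v) = (1 / 2) ^ Suc (length v)" "gauge_wt (End w) = 0"
  by (simp_all add: gauge_wt_def pow_half_def tree_depth_Vertex tree_depth_End)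

lemma gauge_wt_mono: "x \<le> y \<Longrightarrow> gauge_wt x \<le> gauge_wt y"
  by (cases x; cases y) (auto simp: gauge_wt_simps dest!: prefix_length_le intro: power_decreasing)

lemma gauge_wt_eqD:
  assumes "x \<le> y" "gauge_wt x = gauge_wt y"
  shows "x = y"
proof (cases x; cases y)
  fix a b assume xy: "x = Vertex a" "y = Vertex b"
  then have "length a = length b" using assms(2)
    by (simp add: gauge_wt_simps power_inject_exp')
  then show ?thesis using assms(1) xy by (auto simp: prefix_def)
qed (use assms in \<open>auto simp: gauge_wt_simps\<close>)

lemma polytree_dist_alt:
  "polytree_dist \<alpha> \<beta> = (\<Sum>j\<in>UNIV. gauge_wt (lca (\<alpha> j) (\<beta> j))
      - (gauge_wt (\<alpha> j) + gauge_wt (\<beta> j)) / 2)"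
  by (simp add: polytree_dist_def gauge_wt_def)

lemma tree_dist_nonneg: "0 \<le> gauge_wt (lca x y) - (gauge_wt x + gauge_wt y) / 2"
  using gauge_wt_mono[OF lca_props(1)[of x y]] gauge_wt_mono[OF lca_props(2)[of y x]] by simp

lemma tree_dist_zero:
  assumes "gauge_wt (lca x y) - (gauge_wt x + gauge_wt y) / 2 = 0"
  shows "x = y"
proof -
  have "gauge_wt x = gauge_wt (lca x y)" "gauge_wt y = gauge_wt (lca x y)"
    using assms gauge_wt_mono[OF lca_props(1)[of x y]] gauge_wt_mono[OF lca_props(2)[of y x]]
    by simp_all
  then show ?thesis using gauge_wt_eqD lca_props(1,2) by metis
qed

lemma tree_dist_triangle:
  "gauge_wt (lca x z) + gauge_wt y \<le> gauge_wt (lca x y) + gauge_wt (lca y z)"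
proof -
  have "lca x y \<le> lca y z \<or> lca y z \<le> lca x y"
    using ancestors_comparable lca_props(1)[of y z] lca_props(2)[of y x] by blast
  then have "lca x z \<le> lca y z \<or> lca x z \<le> lca x y"
    using lca_props(3)[of x _ z] lca_props(1)[of x y] lca_props(2)[of z y] order_trans by blast
  moreover have "gauge_wt y \<le> gauge_wt (lca x y)" "gauge_wt y \<le> gauge_wt (lca y z)"
    by (intro gauge_wt_mono lca_props)+
  ultimately show ?thesis
    using gauge_wt_mono[of "lca x z" "lca y z"] gauge_wt_mono[of "lca x z" "lca x y"] by auto
qed

lemma Metric_space_polytree_dist:
  "Metric_space UNIV (polytree_dist :: ('d::finite \<Rightarrow> ctree) \<Rightarrow> _)"
proof
  fix \<alpha> \<beta> \<gamma> :: "'d \<Rightarrow> ctree"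
  show "0 \<le> polytree_dist \<alpha> \<beta>"
    unfolding polytree_dist_alt by (intro sum_nonneg tree_dist_nonneg)
  show "polytree_dist \<alpha> \<beta> = polytree_dist \<beta> \<alpha>"
    by (simp add: polytree_dist_alt lca_commute add.commute)
  show "polytree_dist \<alpha> \<beta> = 0 \<longleftrightarrow> \<alpha> = \<beta>"
  proof
    assume "polytree_dist \<alpha> \<beta> = 0"
    then have "gauge_wt (lca (\<alpha> j) (\<beta> j)) - (gauge_wt (\<alpha> j) + gauge_wt (\<beta> j)) / 2 = 0" for j
      unfolding polytree_dist_alt using tree_dist_nonneg
      by (subst (asm) sum_nonneg_eq_0_iff) auto
    then show "\<alpha> = \<beta>" using tree_dist_zero by blast
  qed (simp add: polytree_dist_alt)
  show "polytree_dist \<alpha> \<gamma> \<le> polytree_dist \<alpha> \<beta> + polytree_dist \<beta> \<gamma>"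
    unfolding polytree_dist_alt sum.distrib[symmetric]
  proof (rule sum_mono)
    fix j
    show "gauge_wt (lca (\<alpha> j) (\<gamma> j)) - (gauge_wt (\<alpha> j) + gauge_wt (\<gamma> j)) / 2
      \<le> (gauge_wt (lca (\<alpha> j) (\<beta> j)) - (gauge_wt (\<alpha> j) + gauge_wt (\<beta> j)) / 2)
        + (gauge_wt (lca (\<beta> j) (\<gamma> j)) - (gauge_wt (\<beta> j) + gauge_wt (\<gamma> j)) / 2)"
      using tree_dist_triangle[of "\<alpha> j" "\<gamma> j" "\<beta> j"] by (simp add: field_simps)
  qed
qed

end

theory Submission
  imports Defs
begin

text \<open>The bounds (3) and (4) come from Tonelli and Cauchy--Schwarz: an admissible \<open>f\<close> satisfies
  \<open>\<mu>(E) \<le> \<integral> \<I>f d\<mu> = \<Sum> f \<cdot> \<I>\<^sup>*\<mu> \<cdot> \<pi>\<close>, whose square is at most \<open>\<parallel>f\<parallel>\<^sup>2 \<E>[\<mu>]\<close>. In (3) one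
  first removes a null set and restricts \<open>\<mu>\<close> to the rest of \<open>E\<close>, where the potential is at most 1, so
  that the energy of the restriction is at most its mass. For (1), the sets \<open>\<S>(\<beta>)\<close> with \<open>\<beta>\<^sub>j\<close> running
  through \<open>\<zeta>\<close> and the other coordinates at the root all contain the slice, and each contributes at
  least a fixed multiple of its squared mass to the energy.

  For (2), tensor products of admissible functions are admissible. The converse on product sets needs
  no equilibrium measures: if \<open>f(x, y)\<close> is admissible for \<open>A \<times> B\<close>, then for each \<open>b \<in> B\<close> the function
  \<open>x \<mapsto> (\<I>f(x, \<cdot>))(b)\<close> is admissible for \<open>A\<close>, so by Minkowski's inequality the function
  \<open>y \<mapsto> \<parallel>f(\<cdot>, y)\<parallel>\<close>, divided by the square root of \<open>Cap A\<close>, is admissible for \<open>B\<close>.\<close>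

section \<open>Inequalities for nonnegative integrals\<close>

lemma ennreal_le_of_power2_le:
  fixes a b :: ennreal
  assumes "a\<^sup>2 \<le> b\<^sup>2"
  shows "a \<le> b"
proof (cases a; cases b)
  fix x y assume "0 \<le> x" "a = ennreal x" "0 \<le> y" "b = ennreal y"
  then show ?thesis
    using assms by (auto simp: ennreal_power intro!: ennreal_leI power2_le_imp_le)
qed (use assms in \<open>auto simp: ennreal_power top_unique\<close>)

lemma ennreal_sqrt_exists:
  fixes a :: ennreal
  obtains r where "r\<^sup>2 = a"
proof (cases a)
  case (real x)
  then show thesis by (intro that[of "ennreal (sqrt x)"]) (simp add: ennreal_power)
next
  case top
  then show thesis by (intro that[of top]) simp
qed

text \<open>Cancels one factor \<open>m\<close>. Finiteness of \<open>m\<close> matters: for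
  \<open>m = top\<close> the first premise holds with every nonzero \<open>n\<close>.\<close>

lemma le_of_power2_le_mult:
  fixes m n :: ennreal
  assumes "m\<^sup>2 \<le> n * m" "m < \<infinity>"
  shows "m \<le> n"
proof (cases m; cases n)
  fix x y assume "0 \<le> x" "m = ennreal x" "0 \<le> y" "n = ennreal y"
  then show ?thesis
    using assms(1) by (cases "x = 0") (auto simp: power2_eq_square simp flip: ennreal_mult)
qed (use assms(2) in auto)

lemma Cauchy_Schwarz_weighted:
  fixes f g w :: "'a \<Rightarrow> ennreal"
  shows "(\<integral>\<^sup>+x. f x * g x * w x \<partial>count_space G)\<^sup>2
    \<le> (\<integral>\<^sup>+x. (f x)\<^sup>2 * w x \<partial>count_space G) * (\<integral>\<^sup>+x. (g x)\<^sup>2 * w x \<partial>count_space G)"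
  using Cauchy_Schwarz_nn_integral[of f "density (count_space G) w" g]
  by (simp add: nn_integral_density) (simp add: mult.commute)

text \<open>Both infima are limits of decreasing sequences of attained values, and the bound passes
  to the limit of the products. Finiteness of both infima excludes the product of 0 and
  \<open>\<infinity>\<close>, where multiplication on \<open>ennreal\<close> is
  discontinuous.\<close>

lemma le_mult_INF:
  fixes F :: "'a \<Rightarrow> ennreal"
  assumes le: "\<And>x y. x \<in> X \<Longrightarrow> y \<in> Y \<Longrightarrow> z \<le> F x * H y"
    and fin: "(INF x\<in>X. F x) < \<infinity>" "(INF y\<in>Y. H y) < \<infinity>"
  shows "z \<le> (INF x\<in>X. F x) * (INF y\<in>Y. H y)"
proof -
  from fin have "F ` X \<noteq> {}" "H ` Y \<noteq> {}" by auto
  then obtain u v :: "nat \<Rightarrow> ennreal" where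
    u: "decseq u" "range u \<subseteq> F ` X" "(INF x\<in>X. F x) = (INF i. u i)" and
    v: "decseq v" "range v \<subseteq> H ` Y" "(INF y\<in>Y. H y) = (INF i. v i)"
    using ennreal_Inf_countable_INF by metis
  have "(\<lambda>i. u i * v i) \<longlonglongrightarrow> (INF x\<in>X. F x) * (INF y\<in>Y. H y)"
  proof (rule tendsto_mult_ennreal)
    show "u \<longlonglongrightarrow> (INF x\<in>X. F x)" "v \<longlonglongrightarrow> (INF y\<in>Y. H y)"
      unfolding u(3) v(3) using u(1) v(1) by (simp_all add: LIMSEQ_INF)
    show "\<not> ((INF x\<in>X. F x) = 0 \<and> (INF y\<in>Y. H y) = \<infinity> \<or> (INF x\<in>X. F x) = \<infinity> \<and> (INF y\<in>Y. H y) = 0)"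
      using fin by (metis less_irrefl)
  qed
  moreover have "z \<le> u i * v i" for i
  proof -
    have "u i \<in> F ` X" "v i \<in> H ` Y" using u(2) v(2) by auto
    then show ?thesis using le by auto
  qed
  ultimately show ?thesis by (intro LIMSEQ_le_const) auto
qed

text \<open>The squared integral is expanded into a double integral over \<open>y\<close> and
  \<open>z\<close>, the \<open>x\<close>-integral is moved inside, and Cauchy-Schwarz is applied to
  each pair \<open>(y, z)\<close>. Here \<open>g y\<close> is the weighted \<open>L2\<close> norm of
  \<open>F\<close> in its first variable, specified through its square.\<close>

lemma Minkowski_integral:
  fixes F :: "'a \<Rightarrow> 'b \<Rightarrow> ennreal"
  assumes "countable G" "countable H"
    and g: "\<And>y. y \<in> H \<Longrightarrow> (g y)\<^sup>2 = (\<integral>\<^sup>+x. (F x y)\<^sup>2 * w x \<partial>count_space G)"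
  shows "(\<integral>\<^sup>+x. (\<integral>\<^sup>+y. F x y * v y \<partial>count_space H)\<^sup>2 * w x \<partial>count_space G)
    \<le> (\<integral>\<^sup>+y. g y * v y \<partial>count_space H)\<^sup>2"
proof -
  let ?H = "count_space H" and ?G = "count_space G"
  have sq: "(\<integral>\<^sup>+y. a y \<partial>?H)\<^sup>2 = (\<integral>\<^sup>+y. \<integral>\<^sup>+z. a y * a z \<partial>?H \<partial>?H)" for a :: "'b \<Rightarrow> ennreal"
    by (simp add: power2_eq_square nn_integral_cmult nn_integral_multc)
  have "(\<integral>\<^sup>+x. (\<integral>\<^sup>+y. F x y * v y \<partial>?H)\<^sup>2 * w x \<partial>?G)
      = (\<integral>\<^sup>+x. \<integral>\<^sup>+y. \<integral>\<^sup>+z. v y * v z * (F x y * F x z * w x) \<partial>?H \<partial>?H \<partial>?G)"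
    unfolding sq by (simp add: nn_integral_multc[symmetric]) (simp add: ac_simps)
  also have "\<dots> = (\<integral>\<^sup>+y. \<integral>\<^sup>+z. \<integral>\<^sup>+x. v y * v z * (F x y * F x z * w x) \<partial>?G \<partial>?H \<partial>?H)"
    by (simp add: nn_integral_count_space_nn_integral[OF assms(2), where M = ?G])
  also have "\<dots> \<le> (\<integral>\<^sup>+y. \<integral>\<^sup>+z. v y * v z * (g y * g z) \<partial>?H \<partial>?H)"
  proof (intro nn_integral_mono)
    fix y z assume "y \<in> space ?H" "z \<in> space ?H"
    then have "(\<integral>\<^sup>+x. F x y * F x z * w x \<partial>?G)\<^sup>2 \<le> (g y * g z)\<^sup>2"
      using Cauchy_Schwarz_weighted[of G "\<lambda>x. F x y" "\<lambda>x. F x z" w]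
      by (simp add: g power_mult_distrib)
    then have "(\<integral>\<^sup>+x. F x y * F x z * w x \<partial>?G) \<le> g y * g z"
      by (rule ennreal_le_of_power2_le)
    then show "(\<integral>\<^sup>+x. v y * v z * (F x y * F x z * w x) \<partial>?G) \<le> v y * v z * (g y * g z)"
      by (simp add: nn_integral_cmult mult_left_mono)
  qed
  also have "\<dots> = (\<integral>\<^sup>+y. g y * v y \<partial>?H)\<^sup>2"
    by (simp add: sq ac_simps)
  finally show ?thesis .
qed


section \<open>Capacity of a kernel\<close>

text \<open>Unlike in \<^const>\<open>capacity\<close>, admissible functions may take the value \<open>\<infinity>\<close>; for positive weights this
  does not change the infimum. Index sets instead of types allow induction on the number of factors.\<close>

definition gcap :: "'g set \<Rightarrow> ('g \<Rightarrow> ennreal) \<Rightarrow> ('a \<Rightarrow> 'g \<Rightarrow> ennreal) \<Rightarrow> 'a set \<Rightarrow> ennreal" where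
  "gcap G w K E = (INF f \<in> {f. \<forall>\<alpha>\<in>E. 1 \<le> (\<integral>\<^sup>+\<gamma>. f \<gamma> * K \<alpha> \<gamma> * w \<gamma> \<partial>count_space G)}.
      \<integral>\<^sup>+\<gamma>. (f \<gamma>)\<^sup>2 * w \<gamma> \<partial>count_space G)"

lemma gcap_le:
  assumes "\<And>\<alpha>. \<alpha> \<in> E \<Longrightarrow> 1 \<le> (\<integral>\<^sup>+\<gamma>. f \<gamma> * K \<alpha> \<gamma> * w \<gamma> \<partial>count_space G)"
  shows "gcap G w K E \<le> (\<integral>\<^sup>+\<gamma>. (f \<gamma>)\<^sup>2 * w \<gamma> \<partial>count_space G)"
  unfolding gcap_def using assms by (intro INF_lower) auto

lemma le_gcapI:
  assumes "\<And>f. (\<And>\<alpha>. \<alpha> \<in> E \<Longrightarrow> 1 \<le> (\<integral>\<^sup>+\<gamma>. f \<gamma> * K \<alpha> \<gamma> * w \<gamma> \<partial>count_space G))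
    \<Longrightarrow> c \<le> (\<integral>\<^sup>+\<gamma>. (f \<gamma>)\<^sup>2 * w \<gamma> \<partial>count_space G)"
  shows "c \<le> gcap G w K E"
  unfolding gcap_def using assms by (intro INF_greatest) auto

text \<open>Only the family of constraints indexed by \<open>E\<close> enters the infimum, so
  \<open>k\<close> may identify points, while \<open>h\<close> must be a bijection because sums run
  over \<open>G\<close>. The non-injective case occurs when a coordinate is split off a
  product.\<close>

lemma gcap_reindex:
  assumes h: "bij_betw h G' G" and k: "k ` E' = E"
    and w: "\<And>x. x \<in> G' \<Longrightarrow> w' x = w (h x)"
    and K: "\<And>a x. a \<in> E' \<Longrightarrow> x \<in> G' \<Longrightarrow> K' a x = K (k a) (h x)"
  shows "gcap G w K E = gcap G' w' K' E'"
proof (rule antisym)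
  have pot: "(\<integral>\<^sup>+\<gamma>. f \<gamma> * K (k a) \<gamma> * w \<gamma> \<partial>count_space G)
      = (\<integral>\<^sup>+x. f (h x) * K' a x * w' x \<partial>count_space G')" if "a \<in> E'" for f a
    unfolding nn_integral_bij_count_space[OF h, symmetric]
    by (intro nn_integral_cong) (simp add: w K that)
  have nrm: "(\<integral>\<^sup>+\<gamma>. (f \<gamma>)\<^sup>2 * w \<gamma> \<partial>count_space G)
      = (\<integral>\<^sup>+x. (f (h x))\<^sup>2 * w' x \<partial>count_space G')" for f
    unfolding nn_integral_bij_count_space[OF h, symmetric]
    by (intro nn_integral_cong) (simp add: w)
  show "gcap G' w' K' E' \<le> gcap G w K E"
  proof (rule le_gcapI)
    fix f assume "\<And>\<alpha>. \<alpha> \<in> E \<Longrightarrow> 1 \<le> (\<integral>\<^sup>+\<gamma>. f \<gamma> * K \<alpha> \<gamma> * w \<gamma> \<partial>count_space G)"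
    then show "gcap G' w' K' E' \<le> (\<integral>\<^sup>+\<gamma>. (f \<gamma>)\<^sup>2 * w \<gamma> \<partial>count_space G)"
      unfolding nrm by (intro gcap_le) (use k in \<open>auto simp flip: pot\<close>)
  qed
  show "gcap G w K E \<le> gcap G' w' K' E'"
  proof (rule le_gcapI)
    fix f assume f: "\<And>\<alpha>. \<alpha> \<in> E' \<Longrightarrow> 1 \<le> (\<integral>\<^sup>+\<gamma>. f \<gamma> * K' \<alpha> \<gamma> * w' \<gamma> \<partial>count_space G')"
    define f' where "f' = f \<circ> inv_into G' h"
    have f': "f' (h x) = f x" if "x \<in> G'" for x
      using h that by (simp add: f'_def bij_betw_inv_into_left)
    have "gcap G w K E \<le> (\<integral>\<^sup>+\<gamma>. (f' \<gamma>)\<^sup>2 * w \<gamma> \<partial>count_space G)"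
      by (intro gcap_le) (use k f in \<open>auto simp: pot f' cong: nn_integral_cong_simp\<close>)
    then show "gcap G w K E \<le> (\<integral>\<^sup>+\<gamma>. (f \<gamma>)\<^sup>2 * w' \<gamma> \<partial>count_space G')"
      by (simp add: nrm f' cong: nn_integral_cong_simp)
  qed
qed

lemma nn_integral_count_space_prod:
  assumes "countable G" "countable H"
  shows "(\<integral>\<^sup>+x. \<integral>\<^sup>+y. f (x, y) \<partial>count_space H \<partial>count_space G) = (\<integral>\<^sup>+p. f p \<partial>count_space (G \<times> H))"
proof -
  interpret sigma_finite_measure "count_space H"
    by (rule sigma_finite_measure_count_space_countable[OF assms(2)])
  show ?thesis
    using nn_integral_fst[of f "count_space G"] by (simp add: pair_measure_countable assms)
qed

text \<open>The inductive step for products of trees. Finiteness is what \<open>le_mult_INF\<close>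
  demands for the upper bound, and it allows division by the root of the first capacity in the lower
  bound.\<close>

lemma gcap_prod:
  fixes w :: "'g \<Rightarrow> ennreal" and v :: "'h \<Rightarrow> ennreal"
  assumes cnt: "countable G" "countable H"
    and fin: "gcap G w K A < \<infinity>" "gcap H v L B < \<infinity>"
  shows "gcap (G \<times> H) (\<lambda>(x, y). w x * v y) (\<lambda>(a, b) (x, y). K a x * L b y) (A \<times> B)
    = gcap G w K A * gcap H v L B"
    (is "?P = _")
proof (rule antisym)
  show "?P \<le> gcap G w K A * gcap H v L B"
    unfolding gcap_def[of G] gcap_def[of H]
  proof (rule le_mult_INF)
    fix f g
    assume "f \<in> {f. \<forall>\<alpha>\<in>A. 1 \<le> (\<integral>\<^sup>+\<gamma>. f \<gamma> * K \<alpha> \<gamma> * w \<gamma> \<partial>count_space G)}"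
      and "g \<in> {f. \<forall>\<alpha>\<in>B. 1 \<le> (\<integral>\<^sup>+\<gamma>. f \<gamma> * L \<alpha> \<gamma> * v \<gamma> \<partial>count_space H)}"
    then have f: "\<And>a. a \<in> A \<Longrightarrow> 1 \<le> (\<integral>\<^sup>+x. f x * K a x * w x \<partial>count_space G)"
      and g: "\<And>b. b \<in> B \<Longrightarrow> 1 \<le> (\<integral>\<^sup>+y. g y * L b y * v y \<partial>count_space H)"
      by auto
    have split: "(\<integral>\<^sup>+p. (case p of (x, y) \<Rightarrow> r x * s y) \<partial>count_space (G \<times> H))
        = (\<integral>\<^sup>+x. r x \<partial>count_space G) * (\<integral>\<^sup>+y. s y \<partial>count_space H)" for r s
      by (simp add: nn_integral_count_space_prod[OF cnt, symmetric] nn_integral_cmult nn_integral_multc)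
    have "?P \<le> (\<integral>\<^sup>+p. (case p of (x, y) \<Rightarrow> f x * g y)\<^sup>2 * (case p of (x, y) \<Rightarrow> w x * v y)
        \<partial>count_space (G \<times> H))"
    proof (rule gcap_le)
      fix \<alpha> assume "\<alpha> \<in> A \<times> B"
      then obtain a b where ab: "\<alpha> = (a, b)" "a \<in> A" "b \<in> B" by auto
      have "(1::ennreal) \<le> (\<integral>\<^sup>+x. f x * K a x * w x \<partial>count_space G) * (\<integral>\<^sup>+y. g y * L b y * v y \<partial>count_space H)"
        using mult_mono[OF f[OF ab(2)] g[OF ab(3)]] by simp
      also have "\<dots> = (\<integral>\<^sup>+p. (case p of (x, y) \<Rightarrow> f x * g y) * (case \<alpha> of (a, b) \<Rightarrow> \<lambda>(x, y). K a x * L b y) p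
          * (case p of (x, y) \<Rightarrow> w x * v y) \<partial>count_space (G \<times> H))"
        unfolding split[symmetric] by (intro nn_integral_cong) (auto simp: ab ac_simps)
      finally show "1 \<le> \<dots>" .
    qed
    also have "\<dots> = (\<integral>\<^sup>+x. (f x)\<^sup>2 * w x \<partial>count_space G) * (\<integral>\<^sup>+y. (g y)\<^sup>2 * v y \<partial>count_space H)"
      unfolding split[symmetric]
      by (intro nn_integral_cong) (auto simp: power_mult_distrib ac_simps)
    finally show "?P \<le> \<dots>" .
  qed (use fin in \<open>auto simp: gcap_def\<close>)
next
  let ?c = "gcap G w K A"
  show "?c * gcap H v L B \<le> ?P"
  \<comment> \<open>For \<open>?c = 0\<close> the left side vanishes; otherwise its square root
    \<open>s\<close> is positive and finite, so it can be divided out.\<close>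
  proof (cases "?c = 0")
    case False
    obtain s where s: "s\<^sup>2 = ?c" by (rule ennreal_sqrt_exists)
    with False fin(1) have s0: "s \<noteq> 0" "s < \<infinity>"
      by (cases s; auto)+
    show ?thesis
    proof (rule le_gcapI)
      fix f :: "'g \<times> 'h \<Rightarrow> ennreal"
      assume f: "\<And>\<alpha>. \<alpha> \<in> A \<times> B \<Longrightarrow> 1 \<le> (\<integral>\<^sup>+p. f p * (case \<alpha> of (a, b) \<Rightarrow> \<lambda>(x, y). K a x * L b y) p
          * (case p of (x, y) \<Rightarrow> w x * v y) \<partial>count_space (G \<times> H))"
      \<comment> \<open>\<open>g y\<close> is the norm of the section of \<open>f\<close> at height
        \<open>y\<close>, chosen from the existence of square roots in
        \<open>ennreal\<close>.\<close>
      obtain g where g: "\<And>y. (g y)\<^sup>2 = (\<integral>\<^sup>+x. (f (x, y))\<^sup>2 * w x \<partial>count_space G)"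
      proof -
        have "\<exists>r. r\<^sup>2 = (\<integral>\<^sup>+x. (f (x, y))\<^sup>2 * w x \<partial>count_space G)" for y
          by (rule ennreal_sqrt_exists) blast
        then have "\<exists>g. \<forall>y. (g y)\<^sup>2 = (\<integral>\<^sup>+x. (f (x, y))\<^sup>2 * w x \<partial>count_space G)"
          by (intro choice allI)
        then show thesis using that by blast
      qed
      have "gcap H v L B \<le> (\<integral>\<^sup>+y. (g y / s)\<^sup>2 * v y \<partial>count_space H)"
      proof (rule gcap_le)
        fix b assume b: "b \<in> B"
        \<comment> \<open>Summing out the second variable against \<open>b\<close> leaves a function
          admissible for \<open>A\<close>, so its squared norm is at least the capacity
          \<open>s\<^sup>2\<close>.\<close>
        let ?F = "\<lambda>x. \<integral>\<^sup>+y. f (x, y) * L b y * v y \<partial>count_space H"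
        have "s\<^sup>2 \<le> (\<integral>\<^sup>+x. (?F x)\<^sup>2 * w x \<partial>count_space G)"
          unfolding s
        proof (rule gcap_le)
          fix a assume "a \<in> A"
          then show "1 \<le> (\<integral>\<^sup>+x. ?F x * K a x * w x \<partial>count_space G)"
            using f[of "(a, b)"] b
            by (simp add: nn_integral_count_space_prod[OF cnt, symmetric] nn_integral_multc[symmetric])
               (simp add: ac_simps)
        qed
        \<comment> \<open>The kernel value \<open>L b y\<close> is constant in \<open>x\<close>, so
          it is absorbed into the section and merely scales its norm \<open>g y\<close>.\<close>
        also have "\<dots> \<le> (\<integral>\<^sup>+y. (g y * L b y) * v y \<partial>count_space H)\<^sup>2"
          using cnt
        proof (rule Minkowski_integral)
          fix y
          show "(g y * L b y)\<^sup>2 = (\<integral>\<^sup>+x. (f (x, y) * L b y)\<^sup>2 * w x \<partial>count_space G)"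
            by (simp add: power_mult_distrib g nn_integral_multc[symmetric]) (simp add: ac_simps)
        qed
        finally have "s \<le> (\<integral>\<^sup>+y. (g y * L b y) * v y \<partial>count_space H)"
          by (rule ennreal_le_of_power2_le)
        then have "s / s \<le> (\<integral>\<^sup>+y. (g y * L b y) * v y \<partial>count_space H) / s"
          by (rule divide_right_mono_ennreal)
        also have "\<dots> = (\<integral>\<^sup>+y. g y / s * L b y * v y \<partial>count_space H)"
          by (simp add: divide_ennreal_def nn_integral_multc[symmetric]) (simp add: ac_simps)
        finally show "1 \<le> (\<integral>\<^sup>+y. g y / s * L b y * v y \<partial>count_space H)"
          using s0 by simp
      qed
      then have "?c * gcap H v L B \<le> s\<^sup>2 * (\<integral>\<^sup>+y. (g y / s)\<^sup>2 * v y \<partial>count_space H)"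
        unfolding s by (rule mult_left_mono) simp
      also have "\<dots> = (\<integral>\<^sup>+y. (g y)\<^sup>2 * v y \<partial>count_space H)"
      proof -
        have "s\<^sup>2 * ((g y / s)\<^sup>2 * v y) = (g y)\<^sup>2 * v y" for y
        proof -
          have "s * (g y / s) = g y"
            using s0 by (subst ennreal_times_divide, subst mult.commute) (simp add: ennreal_mult_divide_eq)
          then show ?thesis by (metis mult.assoc power_mult_distrib)
        qed
        then show ?thesis by (simp add: nn_integral_cmult[symmetric])
      qed
      also have "\<dots> = (\<integral>\<^sup>+x. \<integral>\<^sup>+y. (f (x, y))\<^sup>2 * w x * v y \<partial>count_space H \<partial>count_space G)"
        by (simp add: g nn_integral_multc[symmetric]
            nn_integral_count_space_nn_integral[OF cnt(2), where M = "count_space G"])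
      also have "\<dots> = (\<integral>\<^sup>+p. (f p)\<^sup>2 * (case p of (x, y) \<Rightarrow> w x * v y) \<partial>count_space (G \<times> H))"
        by (simp add: nn_integral_count_space_prod[OF cnt, symmetric] ac_simps)
      finally show "?c * gcap H v L B \<le> \<dots>" .
    qed
  qed simp
qed

text \<open>Induction on \<open>J\<close>, one factor at a time. The summation variable is
  extensional, so that each tuple is counted once; the points \<open>\<alpha>\<close> may be
  arbitrary outside \<open>J\<close>, since repeated constraints do not affect the infimum.\<close>

lemma gcap_PiE:
  fixes G :: "'d \<Rightarrow> 'g set" and A :: "'d \<Rightarrow> 'a set"
  assumes "finite J" and cnt: "\<And>j. j \<in> J \<Longrightarrow> countable (G j)"
    and fin: "\<And>j. j \<in> J \<Longrightarrow> gcap (G j) (w j) (K j) (A j) < \<infinity>"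
  shows "gcap (Pi\<^sub>E J G) (\<lambda>\<gamma>. \<Prod>j\<in>J. w j (\<gamma> j)) (\<lambda>\<alpha> \<gamma>. \<Prod>j\<in>J. K j (\<alpha> j) (\<gamma> j))
      {\<alpha>. \<forall>j\<in>J. \<alpha> j \<in> A j} = (\<Prod>j\<in>J. gcap (G j) (w j) (K j) (A j))"
  using assms
proof (induction J rule: finite_induct)
  case empty
  let ?c = "gcap (Pi\<^sub>E {} G) (\<lambda>\<gamma>. \<Prod>j\<in>{}. w j (\<gamma> j)) (\<lambda>\<alpha> \<gamma>. \<Prod>j\<in>{}. K j (\<alpha> j) (\<gamma> j))
      {\<alpha>. \<forall>j\<in>{}. \<alpha> j \<in> A j}"
  have int: "(\<integral>\<^sup>+\<gamma>. f \<gamma> \<partial>count_space {\<lambda>_. undefined}) = f (\<lambda>_. undefined)"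
    for f :: "('d \<Rightarrow> 'g) \<Rightarrow> ennreal"
    by (simp add: nn_integral_count_space_finite)
  \<comment> \<open>Over the empty index set there is one summation point, with weight and kernel
    both 1. Admissibility says that \<open>f\<close> is at least 1 there, so the capacity is the
    empty product.\<close>
  have "?c \<le> 1"
    by (rule order_trans[OF gcap_le[where f = "\<lambda>_. 1"]]) (simp_all add: int)
  moreover have "1 \<le> ?c"
    by (rule le_gcapI) (auto simp: int intro: one_le_power)
  ultimately show ?case by simp
next
  case (insert i J)
  let ?w = "\<lambda>J \<gamma>. \<Prod>j\<in>J. w j (\<gamma> j)" and ?K = "\<lambda>J \<alpha> \<gamma>. \<Prod>j\<in>J. K j (\<alpha> j) (\<gamma> j)"
    and ?E = "\<lambda>J. {\<alpha>. \<forall>j\<in>J. \<alpha> j \<in> A j}"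
  have upd: "(\<Prod>j\<in>J. q j ((\<gamma>(i := x)) j)) = (\<Prod>j\<in>J. q j (\<gamma> j))" for q :: "'d \<Rightarrow> 'x \<Rightarrow> ennreal" and \<gamma> x
    using insert.hyps by (intro prod.cong) auto
  have upd2: "(\<Prod>j\<in>J. K j ((\<alpha>(i := a)) j) ((\<gamma>(i := x)) j)) = (\<Prod>j\<in>J. K j (\<alpha> j) (\<gamma> j))" for \<alpha> a \<gamma> x
    using insert.hyps by (intro prod.cong) auto
  have "gcap (Pi\<^sub>E (insert i J) G) (?w (insert i J)) (?K (insert i J)) (?E (insert i J))
      = gcap (G i \<times> Pi\<^sub>E J G) (\<lambda>(x, \<gamma>). w i x * ?w J \<gamma>)
          (\<lambda>(a, \<alpha>) (x, \<gamma>). K i a x * ?K J \<alpha> \<gamma>) (A i \<times> ?E J)"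
  proof (rule gcap_reindex)
    show "bij_betw (\<lambda>(x, \<gamma>). \<gamma>(i := x)) (G i \<times> Pi\<^sub>E J G) (Pi\<^sub>E (insert i J) G)"
      unfolding bij_betw_def PiE_insert_eq using inj_combinator[OF insert.hyps(2)] by auto
    have "\<alpha> \<in> (\<lambda>(a, \<alpha>). \<alpha>(i := a)) ` (A i \<times> ?E J)" if "\<alpha> \<in> ?E (insert i J)" for \<alpha>
      using that by (intro image_eqI[where x = "(\<alpha> i, \<alpha>)"]) auto
    then show "(\<lambda>(a, \<alpha>). \<alpha>(i := a)) ` (A i \<times> ?E J) = ?E (insert i J)"
      using insert.hyps by auto
  qed (use insert.hyps in \<open>auto simp: upd upd2 simp del: fun_upd_apply, auto\<close>)
  also have "\<dots> = gcap (G i) (w i) (K i) (A i) * gcap (Pi\<^sub>E J G) (?w J) (?K J) (?E J)"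
    using insert by (intro gcap_prod countable_PiE) (auto simp: less_top[symmetric] ennreal_prod_eq_top)
  finally show ?case using insert by simp
qed

section \<open>Capacities on the polytree\<close>

text \<open>Moves the restriction of the sum to ancestors into a 0-1 kernel, the form required by
  \<open>gcap\<close>.\<close>

lemma hardy_eq:
  "hardy \<pi> f \<alpha> = (\<integral>\<^sup>+\<gamma>. f \<gamma> * of_bool (\<alpha> \<le> emb \<gamma>) * ennreal (\<pi> \<gamma>) \<partial>count_space UNIV)"
  unfolding hardy_def
  by (subst nn_integral_count_space_indicator) (auto intro!: nn_integral_cong simp: indicator_def)

text \<open>Allowing infinite values adds no better competitor: where \<open>f\<close> is infinite
  the weight is positive, so the norm is already infinite.\<close>

lemma capacity_eq_gcap:
  assumes "\<And>\<gamma>. 0 < \<pi> \<gamma>"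
  shows "capacity \<pi> E = gcap UNIV (\<lambda>\<gamma>. ennreal (\<pi> \<gamma>)) (\<lambda>\<alpha> \<gamma>. of_bool (\<alpha> \<le> emb \<gamma>)) E"
proof (rule antisym)
  show "gcap UNIV (\<lambda>\<gamma>. ennreal (\<pi> \<gamma>)) (\<lambda>\<alpha> \<gamma>. of_bool (\<alpha> \<le> emb \<gamma>)) E \<le> capacity \<pi> E"
    unfolding capacity_def by (intro INF_greatest gcap_le) (simp add: hardy_eq)
next
  show "capacity \<pi> E \<le> gcap UNIV (\<lambda>\<gamma>. ennreal (\<pi> \<gamma>)) (\<lambda>\<alpha> \<gamma>. of_bool (\<alpha> \<le> emb \<gamma>)) E"
  proof (rule le_gcapI)
    fix f assume f: "\<And>\<alpha>. \<alpha> \<in> E \<Longrightarrow> 1 \<le> (\<integral>\<^sup>+\<gamma>. f \<gamma> * of_bool (\<alpha> \<le> emb \<gamma>) * ennreal (\<pi> \<gamma>) \<partial>count_space UNIV)"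
    let ?N = "\<integral>\<^sup>+\<gamma>. (f \<gamma>)\<^sup>2 * ennreal (\<pi> \<gamma>) \<partial>count_space UNIV"
    show "capacity \<pi> E \<le> ?N"
    proof (cases "\<forall>\<gamma>. f \<gamma> < \<infinity>")
      case True
      then show ?thesis unfolding capacity_def by (intro INF_lower) (simp add: f hardy_eq)
    next
      case False
      then obtain \<gamma> where "f \<gamma> = top" by (metis infinity_ennreal_def less_top)
      then have "(f \<gamma>)\<^sup>2 * ennreal (\<pi> \<gamma>) = top"
        using assms[of \<gamma>] by (simp add: ennreal_top_mult ennreal_eq_0_iff)
      then have "?N = top"
        using nn_integral_ge_point[of \<gamma> UNIV "\<lambda>\<gamma>. (f \<gamma>)\<^sup>2 * ennreal (\<pi> \<gamma>)"] by (simp add: top_unique)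
      then show ?thesis by simp
    qed
  qed
qed

lemma capacity_mono: "E \<subseteq> F \<Longrightarrow> capacity \<pi> E \<le> capacity \<pi> F"
  unfolding capacity_def by (intro INF_superset_mono) auto

text \<open>Removes the one-point index type by identifying a function on \<open>unit\<close> with
  its value.\<close>

lemma tree_capacity_eq_gcap:
  assumes "\<And>v. 0 < p v"
  shows "tree_capacity p A = gcap UNIV (\<lambda>v. ennreal (p v)) (\<lambda>x v. of_bool (x \<le> Vertex v)) A"
  unfolding tree_capacity_def capacity_eq_gcap[OF assms]
proof (rule gcap_reindex)
  show "bij_betw (\<lambda>v (_::unit). v) UNIV UNIV"
    by (rule bij_betwI[where g = "\<lambda>\<gamma>. \<gamma> ()"]) auto
  show "(\<lambda>x _. x) ` A = {\<alpha>. \<alpha> () \<in> A}"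
  proof (intro set_eqI iffI)
    fix \<alpha> :: "unit \<Rightarrow> ctree" assume "\<alpha> \<in> {\<alpha>. \<alpha> () \<in> A}"
    then show "\<alpha> \<in> (\<lambda>x _. x) ` A" by (intro image_eqI[where x = "\<alpha> ()"]) auto
  qed auto
qed (auto simp: le_fun_def emb_def)

lemma le_root: "x \<le> Vertex []"
  by (cases x) auto

text \<open>Every point lies below the root, so the function supported at the root with value
  \<open>1 / p []\<close> is admissible, with norm squared \<open>1 / p []\<close>. This supplies
  the finiteness hypothesis of \<open>gcap_PiE\<close>.\<close>

lemma tree_capacity_finite:
  assumes "\<And>v. 0 < p v"
  shows "tree_capacity p A < \<infinity>"
proof -
  define f where "f v = (if v = [] then inverse (ennreal (p [])) else 0)" for v :: vertex
  have *: "(\<integral>\<^sup>+v. h v \<partial>count_space UNIV) = h []" if "\<And>v. v \<noteq> [] \<Longrightarrow> h v = 0" for h :: "vertex \<Rightarrow> ennreal"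
    by (subst nn_integral_count_space'[of "{[]}"]) (use that in auto)
  have "tree_capacity p A \<le> (\<integral>\<^sup>+v. (f v)\<^sup>2 * ennreal (p v) \<partial>count_space UNIV)"
    unfolding tree_capacity_eq_gcap[OF assms]
  proof (rule gcap_le)
    fix x
    show "1 \<le> (\<integral>\<^sup>+v. f v * of_bool (x \<le> Vertex v) * ennreal (p v) \<partial>count_space UNIV)"
      using assms[of "[]"] by (subst *) (simp_all add: f_def le_root ennreal_inverse_mult inverse_ennreal flip: ennreal_mult)
  qed
  also have "\<dots> < \<infinity>"
    using assms[of "[]"] by (subst *) (simp_all add: f_def inverse_ennreal ennreal_power flip: ennreal_mult)
  finally show ?thesis .
qed

text \<open>The coordinatewise order and the product weight both factor over the coordinates, which
  puts the capacity in the form of \<open>gcap_PiE\<close>.\<close>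

lemma capacity_box:
  fixes p :: "'d::finite \<Rightarrow> vertex \<Rightarrow> real"
  assumes p: "\<And>j v. 0 < p j v" and \<pi>: "\<And>\<beta>. \<pi> \<beta> = (\<Prod>j\<in>UNIV. p j (\<beta> j))"
  shows "capacity \<pi> {\<alpha>. \<forall>j. \<alpha> j \<in> A j} = (\<Prod>j\<in>UNIV. tree_capacity (p j) (A j))"
proof -
  have "of_bool (\<alpha> \<le> emb \<gamma>) = (\<Prod>j\<in>UNIV. of_bool (\<alpha> j \<le> Vertex (\<gamma> j)) :: ennreal)"
    for \<alpha> and \<gamma> :: "'d \<Rightarrow> vertex"
    by (auto simp: le_fun_def emb_def)
  moreover have "ennreal (\<pi> \<gamma>) = (\<Prod>j\<in>UNIV. ennreal (p j (\<gamma> j)))" for \<gamma>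
    using p by (simp add: \<pi> prod_ennreal less_imp_le)
  moreover have "0 < \<pi> \<gamma>" for \<gamma> using p by (simp add: \<pi> prod_pos)
  ultimately have "capacity \<pi> {\<alpha>. \<forall>j. \<alpha> j \<in> A j}
    = gcap (Pi\<^sub>E UNIV (\<lambda>_. UNIV)) (\<lambda>\<gamma>. \<Prod>j\<in>UNIV. ennreal (p j (\<gamma> j)))
      (\<lambda>\<alpha> \<gamma>. \<Prod>j\<in>UNIV. of_bool (\<alpha> j \<le> Vertex (\<gamma> j))) {\<alpha>. \<forall>j\<in>UNIV. \<alpha> j \<in> A j}"
    by (simp add: capacity_eq_gcap)
  also have "\<dots> = (\<Prod>j\<in>UNIV. tree_capacity (p j) (A j))"
    unfolding tree_capacity_eq_gcap[OF p]
    by (rule gcap_PiE[where G = "\<lambda>_. UNIV"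
          and w = "\<lambda>j v. ennreal (p j v)" and K = "\<lambda>_ x v. of_bool (x \<le> Vertex v)"])
       (simp_all add: tree_capacity_finite[OF p, simplified] flip: tree_capacity_eq_gcap[OF p])
  finally show ?thesis .
qed

section \<open>Measures of finite energy\<close>

lemma space_polytree_borel [simp]: "space polytree_borel = UNIV"
  by (simp add: polytree_borel_def space_measure_of)

lemma polytree_borel_openin:
  "openin (Metric_space.mtopology UNIV polytree_dist) U \<Longrightarrow> U \<in> sets polytree_borel"
  by (simp add: polytree_borel_def sets_measure_of)

text \<open>The common ancestor lies strictly above \<open>b\<close>, so its weight is at least
  twice that of \<open>b\<close>, while \<open>x\<close> weighs at most as much as \<open>b\<close>
  and \<open>y\<close> at most as much as the ancestor. Hence a ball of this radius around a point
  below \<open>b\<close> stays below \<open>b\<close>, and subtrees are open.\<close>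

lemma gauge_wt_lca_far:
  assumes x: "x \<le> Vertex b" and y: "\<not> y \<le> Vertex b"
  shows "gauge_wt (Vertex b) / 2 \<le> gauge_wt (lca x y) - (gauge_wt x + gauge_wt y) / 2"
proof -
  have "\<not> lca x y \<le> Vertex b" using y lca_props(2) order_trans by blast
  then have le: "Vertex b \<le> lca x y" "Vertex b \<noteq> lca x y"
    using ancestors_comparable[OF x lca_props(1)[of x y]] by auto
  then obtain c where c: "lca x y = Vertex c" by (cases "lca x y") auto
  with le have "strict_prefix c b" by (auto simp: strict_prefix_def)
  then have "Suc (length c) \<le> length b" using prefix_length_less by fastforce
  then have "(1/2) ^ Suc (length b) \<le> ((1/2) ^ Suc (Suc (length c)) :: real)"
    by (intro power_decreasing) auto
  then have "2 * gauge_wt (Vertex b) \<le> gauge_wt (lca x y)" by (simp add: c gauge_wt_simps)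
  moreover have "gauge_wt x \<le> gauge_wt (Vertex b)" "gauge_wt y \<le> gauge_wt (lca x y)"
    using x by (auto intro: gauge_wt_mono lca_props)
  ultimately show ?thesis by (simp add: field_simps)
qed

lemma sets_le_Vertex:
  "{\<alpha>. \<alpha> j \<le> Vertex b} \<in> sets (polytree_borel :: ('d::finite \<Rightarrow> ctree) measure)"
proof (rule polytree_borel_openin)
  interpret Metric_space UNIV "polytree_dist :: ('d \<Rightarrow> ctree) \<Rightarrow> _"
    by (rule Metric_space_polytree_dist)
  let ?r = "gauge_wt (Vertex b) / 2"
  have "mball \<alpha> ?r \<subseteq> {\<alpha>. \<alpha> j \<le> Vertex b}" if a: "\<alpha> j \<le> Vertex b" for \<alpha> :: "'d \<Rightarrow> ctree"
  proof (rule subsetI, rule ccontr)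
    fix \<beta> :: "'d \<Rightarrow> ctree" assume b: "\<beta> \<in> mball \<alpha> ?r" "\<beta> \<notin> {\<alpha>. \<alpha> j \<le> Vertex b}"
    then have "?r \<le> gauge_wt (lca (\<alpha> j) (\<beta> j)) - (gauge_wt (\<alpha> j) + gauge_wt (\<beta> j)) / 2"
      using a by (intro gauge_wt_lca_far) auto
    also have "\<dots> \<le> polytree_dist \<alpha> \<beta>"
      unfolding polytree_dist_alt by (intro member_le_sum tree_dist_nonneg) auto
    finally show False using b(1) by simp
  qed
  moreover have "0 < ?r" by (simp add: gauge_wt_simps)
  ultimately show "openin mtopology {\<alpha>. \<alpha> j \<le> Vertex b}"
    unfolding openin_mtopology by blast
qed

lemma sets_le_emb:
  "{\<alpha>. \<alpha> \<le> emb \<beta>} \<in> sets (polytree_borel :: ('d::finite \<Rightarrow> ctree) measure)"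
proof -
  have "{\<alpha>. \<alpha> \<le> emb \<beta>} = (\<Inter>j. {\<alpha>. \<alpha> j \<le> Vertex (\<beta> j)})"
    by (auto simp: le_fun_def emb_def)
  then show ?thesis by (simp add: sets.finite_INT sets_le_Vertex)
qed

text \<open>A countable sum of multiples of indicators of Borel sets. Since the vertex factor is
  countable and discrete, joint measurability need only be checked with \<open>\<gamma>\<close>
  fixed.\<close>

lemma borel_measurable_hardy:
  "hardy \<pi> f \<in> borel_measurable (polytree_borel :: ('d::finite \<Rightarrow> ctree) measure)"
proof -
  have [measurable]: "(\<lambda>\<alpha>. of_bool (\<alpha> \<le> emb \<gamma>) :: ennreal) \<in> borel_measurable polytree_borel"
    for \<gamma> :: "'d \<Rightarrow> vertex"
  proof -
    have "(\<lambda>\<alpha>. of_bool (\<alpha> \<le> emb \<gamma>) :: ennreal) = indicator {\<alpha>. \<alpha> \<le> emb \<gamma>}"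
      by (auto simp: indicator_def)
    then show ?thesis using sets_le_emb[of \<gamma>] by simp
  qed
  interpret sigma_finite_measure "count_space (UNIV :: ('d \<Rightarrow> vertex) set)"
    by (rule sigma_finite_measure_count_space)
  have "(\<lambda>(\<gamma>, \<alpha>). f \<gamma> * of_bool (\<alpha> \<le> emb \<gamma>) * ennreal (\<pi> \<gamma>))
      \<in> borel_measurable (count_space UNIV \<Otimes>\<^sub>M polytree_borel)"
    by (intro measurable_pair_measure_countable1) simp_all
  then have "(\<lambda>(\<alpha>, \<gamma>). f \<gamma> * of_bool (\<alpha> \<le> emb \<gamma>) * ennreal (\<pi> \<gamma>))
      \<in> borel_measurable (polytree_borel \<Otimes>\<^sub>M count_space UNIV)"
    by (subst measurable_pair_swap_iff) (simp add: split_def)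
  then show ?thesis
    unfolding hardy_eq[abs_def] by (rule borel_measurable_nn_integral)
qed

text \<open>Tonelli for a countable sum: \<open>hardy\<close> and \<open>hardy_adj\<close> are
  adjoint with respect to the weight.\<close>

lemma nn_integral_hardy:
  assumes "sets \<mu> = sets polytree_borel"
  shows "(\<integral>\<^sup>+\<alpha>. hardy \<pi> f \<alpha> \<partial>\<mu>)
    = (\<integral>\<^sup>+\<gamma>. f \<gamma> * hardy_adj \<mu> \<gamma> * ennreal (\<pi> \<gamma>) \<partial>count_space UNIV)"
proof -
  have S: "{\<alpha>. \<alpha> \<le> emb \<gamma>} \<in> sets \<mu>" for \<gamma> by (simp add: assms sets_le_emb)
  have ind: "of_bool (\<alpha> \<le> emb \<gamma>) = (indicator {\<alpha>. \<alpha> \<le> emb \<gamma>} \<alpha> :: ennreal)" for \<alpha> \<gamma>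
    by (simp add: indicator_def)
  have "(\<integral>\<^sup>+\<alpha>. hardy \<pi> f \<alpha> \<partial>\<mu>)
      = (\<integral>\<^sup>+\<gamma>. \<integral>\<^sup>+\<alpha>. f \<gamma> * indicator {\<alpha>. \<alpha> \<le> emb \<gamma>} \<alpha> * ennreal (\<pi> \<gamma>) \<partial>\<mu> \<partial>count_space UNIV)"
    unfolding hardy_eq ind using S by (intro nn_integral_count_space_nn_integral) auto
  also have "\<dots> = (\<integral>\<^sup>+\<gamma>. f \<gamma> * hardy_adj \<mu> \<gamma> * ennreal (\<pi> \<gamma>) \<partial>count_space UNIV)"
    using S by (simp add: nn_integral_multc nn_integral_cmult hardy_adj_def)
  finally show ?thesis .
qed

section \<open>Testing measures against admissible functions\<close>

lemma nn_integral_hardy_power2_le: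
  assumes "sets \<mu> = sets polytree_borel"
  shows "(\<integral>\<^sup>+\<alpha>. hardy \<pi> f \<alpha> \<partial>\<mu>)\<^sup>2
    \<le> (\<integral>\<^sup>+\<gamma>. (f \<gamma>)\<^sup>2 * ennreal (\<pi> \<gamma>) \<partial>count_space UNIV) * energy \<pi> \<mu>"
  unfolding nn_integral_hardy[OF assms] energy_def by (rule Cauchy_Schwarz_weighted)

lemma energy_eq_nn_integral_potential:
  assumes "sets \<mu> = sets polytree_borel"
  shows "energy \<pi> \<mu> = (\<integral>\<^sup>+\<alpha>. potential \<pi> \<mu> \<alpha> \<partial>\<mu>)"
  by (simp add: potential_def nn_integral_hardy[OF assms] energy_def power2_eq_square)

text \<open>The potential of \<open>f\<close> dominates the indicator of \<open>E\<close>, and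
  Cauchy-Schwarz bounds its integral. If \<open>E\<close> is not measurable, \<open>emeasure\<close>
  takes its default value 0.\<close>

lemma emeasure_power2_le:
  assumes sets: "sets \<mu> = sets polytree_borel"
    and ge: "\<And>\<alpha>. \<alpha> \<in> E \<Longrightarrow> 1 \<le> hardy \<pi> f \<alpha>"
  shows "(emeasure \<mu> E)\<^sup>2 \<le> (\<integral>\<^sup>+\<gamma>. (f \<gamma>)\<^sup>2 * ennreal (\<pi> \<gamma>) \<partial>count_space UNIV) * energy \<pi> \<mu>"
proof (cases "E \<in> sets \<mu>")
  case True
  then have "emeasure \<mu> E = (\<integral>\<^sup>+\<alpha>. indicator E \<alpha> \<partial>\<mu>)" by simp
  also have "\<dots> \<le> (\<integral>\<^sup>+\<alpha>. hardy \<pi> f \<alpha> \<partial>\<mu>)"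
    using ge by (intro nn_integral_mono) (auto simp: indicator_def)
  finally have "(emeasure \<mu> E)\<^sup>2 \<le> (\<integral>\<^sup>+\<alpha>. hardy \<pi> f \<alpha> \<partial>\<mu>)\<^sup>2" by (rule power_mono_ennreal)
  then show ?thesis using nn_integral_hardy_power2_le[OF sets] by (rule order_trans)
qed (simp add: emeasure_notin_sets)

text \<open>Once the energy is at most the mass of \<open>E\<close>, one factor of that mass cancels
  in the bound for each admissible \<open>f\<close>. Both (3) and (4) reduce to this.\<close>

lemma emeasure_le_capacity:
  assumes "sets \<mu> = sets polytree_borel" "emeasure \<mu> E < \<infinity>" "energy \<pi> \<mu> \<le> emeasure \<mu> E"
  shows "emeasure \<mu> E \<le> capacity \<pi> E"
  unfolding capacity_def
proof (rule INF_greatest, clarify)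
  fix f assume "\<forall>\<alpha>\<in>E. 1 \<le> hardy \<pi> f \<alpha>"
  then have "(emeasure \<mu> E)\<^sup>2 \<le> (\<integral>\<^sup>+\<gamma>. (f \<gamma>)\<^sup>2 * ennreal (\<pi> \<gamma>) \<partial>count_space UNIV) * energy \<pi> \<mu>"
    by (intro emeasure_power2_le assms) simp
  also have "\<dots> \<le> (\<integral>\<^sup>+\<gamma>. (f \<gamma>)\<^sup>2 * ennreal (\<pi> \<gamma>) \<partial>count_space UNIV) * emeasure \<mu> E"
    by (intro mult_left_mono assms) simp
  finally show "emeasure \<mu> E \<le> (\<integral>\<^sup>+\<gamma>. (f \<gamma>)\<^sup>2 * ennreal (\<pi> \<gamma>) \<partial>count_space UNIV)"
    using assms(2) by (rule le_of_power2_le_mult)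
qed

lemma le_emb_root: "\<alpha> \<le> emb (\<lambda>_. [])"
  by (simp add: le_fun_def emb_def le_root)

text \<open>The root term of the energy is the square of the total mass times a positive
  weight.\<close>

lemma energy_finite_imp_emeasure_finite:
  assumes sets: "sets \<mu> = sets polytree_borel" and fin: "energy \<pi> \<mu> < \<infinity>" and \<pi>: "\<And>\<gamma>. 0 < \<pi> \<gamma>"
  shows "emeasure \<mu> E < \<infinity>"
proof -
  let ?o = "\<lambda>_. []"
  have "(hardy_adj \<mu> ?o)\<^sup>2 * ennreal (\<pi> ?o) \<le> energy \<pi> \<mu>"
    unfolding energy_def by (rule nn_integral_ge_point) simp
  then have "(hardy_adj \<mu> ?o)\<^sup>2 * ennreal (\<pi> ?o) < top" using fin by simp
  then have "hardy_adj \<mu> ?o < top"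
    using \<pi>[of ?o] by (auto simp: ennreal_mult_less_top power_less_top_ennreal)
  moreover have "emeasure \<mu> E \<le> hardy_adj \<mu> ?o"
    using emeasure_space[of \<mu> E] sets_eq_imp_space_eq[OF sets] by (simp add: hardy_adj_def le_emb_root)
  ultimately show ?thesis by simp
qed

text \<open>An exceptional set \<open>N\<close> may fail to be Borel, so it is enclosed in a Borel
  set \<open>Z\<close>: the points where the potentials of a whole minimizing sequence are at least
  1. The norms tend to 0, which forces \<open>Z\<close> to be null.\<close>

lemma capacity_zero_null_cover:
  assumes sets: "sets \<mu> = sets polytree_borel" and fin: "energy \<pi> \<mu> < \<infinity>"
    and N: "capacity \<pi> N = 0"
  obtains Z where "Z \<in> null_sets \<mu>" "N \<subseteq> Z"
proof -
  let ?n = "\<lambda>f. \<integral>\<^sup>+\<gamma>. (f \<gamma>)\<^sup>2 * ennreal (\<pi> \<gamma>) \<partial>count_space UNIV"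
  let ?F = "{f. (\<forall>\<gamma>. f \<gamma> < \<infinity>) \<and> (\<forall>\<alpha>\<in>N. 1 \<le> hardy \<pi> f \<alpha>)}"
  have inf: "(INF f\<in>?F. ?n f) = 0" using N by (simp add: capacity_def)
  have "?n ` ?F \<noteq> {}"
  proof
    assume "?n ` ?F = {}"
    then show False using inf by (simp only:) simp
  qed
  from ennreal_Inf_countable_INF[OF this] obtain u :: "nat \<Rightarrow> ennreal" where
    "decseq u \<and> range u \<subseteq> ?n ` ?F \<and> (INF f\<in>?F. ?n f) = (INF i. u i)" by (rule exE)
  then have u: "decseq u" "range u \<subseteq> ?n ` ?F" "(INF i. u i) = 0" unfolding inf by (elim conjE, simp)+
  have "\<exists>f\<in>?F. u i = ?n f" for i using u(2) by blast
  then have "\<exists>f. \<forall>i. f i \<in> ?F \<and> u i = ?n (f i)" by (intro choice) blast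
  then obtain f where f: "\<And>i. f i \<in> ?F" "\<And>i. u i = ?n (f i)" by blast
  define Z where "Z = {\<alpha>. \<forall>i. 1 \<le> hardy \<pi> (f i) \<alpha>}"
  have [measurable]: "hardy \<pi> (f i) \<in> borel_measurable polytree_borel" for i
    by (rule borel_measurable_hardy)
  have "{\<alpha> \<in> space polytree_borel. \<forall>i. 1 \<le> hardy \<pi> (f i) \<alpha>} \<in> sets polytree_borel" by measurable
  then have Z: "Z \<in> sets \<mu>" by (simp add: Z_def sets)
  \<comment> \<open>Finite energy keeps this limit away from the indeterminate product of 0 and
    \<open>\<infinity>\<close>.\<close>
  have "(\<lambda>i. u i * energy \<pi> \<mu>) \<longlonglongrightarrow> 0 * energy \<pi> \<mu>"
    using LIMSEQ_INF[OF u(1)] fin by (intro tendsto_mult_ennreal) (auto simp: u(3))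
  moreover have "(emeasure \<mu> Z)\<^sup>2 \<le> u i * energy \<pi> \<mu>" for i
    unfolding f(2) by (rule emeasure_power2_le[OF sets]) (simp add: Z_def)
  ultimately have "(emeasure \<mu> Z)\<^sup>2 \<le> 0" by (intro LIMSEQ_le_const) auto
  then have "Z \<in> null_sets \<mu>" using Z by auto
  moreover have "N \<subseteq> Z" using f(1) by (auto simp: Z_def)
  ultimately show thesis by (rule that)
qed

lemma emeasure_le_capacity_of_potential_le:
  assumes sets: "sets \<mu> = sets polytree_borel" and fin: "energy \<pi> \<mu> < \<infinity>" and \<pi>: "\<And>\<gamma>. 0 < \<pi> \<gamma>"
    and E: "E \<in> sets polytree_borel" and qae: "holds_qae \<pi> E (\<lambda>\<alpha>. potential \<pi> \<mu> \<alpha> \<le> 1)"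
  shows "emeasure \<mu> E \<le> capacity \<pi> E"
proof -
  obtain N where N: "capacity \<pi> N = 0" "\<And>\<alpha>. \<alpha> \<in> E - N \<Longrightarrow> potential \<pi> \<mu> \<alpha> \<le> 1"
    using qae by (auto simp: holds_qae_def)
  obtain Z where Z: "Z \<in> null_sets \<mu>" "N \<subseteq> Z"
    by (rule capacity_zero_null_cover[OF sets fin N(1)])
  define D where "D = E - Z"
  \<comment> \<open>The part of \<open>\<mu>\<close> on \<open>D\<close>, kept as a measure on the
    whole space so that its energy makes sense.\<close>
  define \<nu> where "\<nu> = density \<mu> (indicator D)"
  have D: "D \<in> sets \<mu>" using E Z(1) by (auto simp: D_def sets)
  have \<nu>: "sets \<nu> = sets polytree_borel" by (simp add: \<nu>_def sets)
  have em: "emeasure \<nu> A = emeasure \<mu> (D \<inter> A)" if "A \<in> sets \<mu>" for A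
    using that D by (simp add: \<nu>_def emeasure_restricted)
  have "hardy_adj \<nu> \<gamma> \<le> hardy_adj \<mu> \<gamma>" for \<gamma>
    using sets_le_emb[of \<gamma>] by (simp add: hardy_adj_def em sets emeasure_mono)
  then have pot: "potential \<pi> \<nu> \<alpha> \<le> potential \<pi> \<mu> \<alpha>" for \<alpha>
    unfolding potential_def hardy_def by (intro nn_integral_mono mult_right_mono) auto
  have "potential \<pi> \<nu> \<in> borel_measurable \<mu>"
    unfolding potential_def measurable_cong_sets[OF sets refl] by (rule borel_measurable_hardy)
  moreover have "(\<integral>\<^sup>+\<alpha>. h \<alpha> \<partial>\<nu>) = (\<integral>\<^sup>+\<alpha>. indicator D \<alpha> * h \<alpha> \<partial>\<mu>)"
    if "h \<in> borel_measurable \<mu>" for h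
    unfolding \<nu>_def using D that by (intro nn_integral_density) auto
  \<comment> \<open>The energy of \<open>\<nu>\<close> is an integral over \<open>D\<close> only,
    where its potential, dominated by that of \<open>\<mu>\<close>, is at most 1.\<close>
  ultimately have "energy \<pi> \<nu> = (\<integral>\<^sup>+\<alpha>. indicator D \<alpha> * potential \<pi> \<nu> \<alpha> \<partial>\<mu>)"
    by (simp add: energy_eq_nn_integral_potential[OF \<nu>])
  also have "\<dots> \<le> (\<integral>\<^sup>+\<alpha>. indicator D \<alpha> \<partial>\<mu>)"
    using N(2) Z(2) by (intro nn_integral_mono) (auto simp: indicator_def D_def intro: order_trans[OF pot])
  also have "\<dots> = emeasure \<nu> E"
    using D E by (simp add: em sets) (simp add: D_def Int_absorb2 Diff_subset)
  finally have "emeasure \<nu> E \<le> capacity \<pi> E"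
    using energy_finite_imp_emeasure_finite[OF sets fin \<pi>] E
    by (intro emeasure_le_capacity \<nu>) (simp_all add: em sets)
  moreover have "emeasure \<nu> E = emeasure \<mu> E"
  proof -
    have "D \<inter> E = E - Z" by (auto simp: D_def)
    then show ?thesis using E Z(1) by (simp add: em sets emeasure_Diff_null_set)
  qed
  ultimately show ?thesis by simp
qed

section \<open>Slices over a single boundary point\<close>

lemma eq_End_iff: "x = End w \<longleftrightarrow> x \<in> range End \<and> (\<forall>n. x \<le> Vertex (map w [0..<n]))"
proof
  assume r: "x \<in> range End \<and> (\<forall>n. x \<le> Vertex (map w [0..<n]))"
  then obtain w' where w': "x = End w'" by auto
  have "w i = w' i" for i
    using r w' spec[of "\<lambda>n. x \<le> Vertex (map w [0..<n])" "Suc i"] by (auto simp del: upt_Suc)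
  then show "x = End w" using w' by auto
qed auto

lemma slice_null:
  fixes \<mu> :: "('d::finite \<Rightarrow> ctree) measure"
  assumes \<pi>: "\<And>\<gamma>. 0 < \<pi> \<gamma>" "0 < (INF \<gamma>. \<pi> \<gamma>)"
    and sets: "sets \<mu> = sets (restrict_space polytree_borel bdry)"
    and fin: "energy \<pi> (distr \<mu> polytree_borel (\<lambda>\<omega>. \<omega>)) < \<infinity>"
  shows "{\<omega> \<in> bdry. \<omega> j = End w} \<in> null_sets \<mu>"
proof -
  let ?\<nu> = "distr \<mu> polytree_borel (\<lambda>\<omega>. \<omega>)" and ?S = "{\<omega> \<in> bdry. \<omega> j = End w}"
  \<comment> \<open>The \<open>n\<close>-th vertex of the ray \<open>w\<close> in coordinate
    \<open>j\<close>, the root elsewhere. Prefixes of different lengths differ, so the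
    \<open>b n\<close> index distinct terms of the energy.\<close>
  define b where "b n = (\<lambda>_. [])(j := map w [0..<n])" for n
  have b_inj: "inj b"
  proof (rule injI)
    fix m n assume "b m = b n"
    then have "length (b m j) = length (b n j)" by simp
    then show "m = n" by (simp add: b_def)
  qed
  have space: "space \<mu> = bdry"
    using sets_eq_imp_space_eq[OF sets] by (simp add: space_restrict_space)
  have meas: "(\<lambda>\<omega>. \<omega>) \<in> \<mu> \<rightarrow>\<^sub>M polytree_borel"
    using sets measurable_restrict_space1[OF measurable_ident]
    by (simp add: measurable_cong_sets[OF sets refl] id_def)
  have le_b: "\<alpha> \<le> emb (b n) \<longleftrightarrow> \<alpha> j \<le> Vertex (map w [0..<n])" for \<alpha> n
    by (auto simp: le_fun_def emb_def b_def le_root)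
  \<comment> \<open>Inside the boundary the slice is a countable intersection of subtrees, hence
    measurable for the trace of the Borel sets.\<close>
  have "?S = (\<Inter>n. {\<alpha>. \<alpha> j \<le> Vertex (map w [0..<n])}) \<inter> bdry"
    using eq_End_iff[of _ w] by (auto simp: bdry_def)
  then have S: "?S \<in> sets \<mu>"
    unfolding sets sets_restrict_space by (auto intro!: image_eqI sets_le_Vertex)
  have S_le: "emeasure \<mu> ?S \<le> hardy_adj ?\<nu> (b n)" for n
    unfolding hardy_adj_def le_b using meas measurable_sets[OF meas sets_le_Vertex[of j "map w [0..<n]"]]
    by (subst emeasure_distr) (auto simp: sets_le_Vertex space intro!: emeasure_mono)
  let ?c = "INF \<gamma>. \<pi> \<gamma>"
  have c_le: "?c \<le> \<pi> \<gamma>" for \<gamma>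
    using \<pi>(1) by (intro cINF_lower bdd_belowI[of _ 0]) (auto intro: less_imp_le)
  have "(\<integral>\<^sup>+n. (emeasure \<mu> ?S)\<^sup>2 * ennreal ?c \<partial>count_space (UNIV :: nat set))
      \<le> (\<integral>\<^sup>+n. (hardy_adj ?\<nu> (b n))\<^sup>2 * ennreal (\<pi> (b n)) \<partial>count_space UNIV)"
    by (intro nn_integral_mono mult_mono power_mono_ennreal S_le ennreal_leI c_le) auto
  also have "\<dots> = (\<integral>\<^sup>+\<gamma>. (hardy_adj ?\<nu> \<gamma>)\<^sup>2 * ennreal (\<pi> \<gamma>) \<partial>count_space (range b))"
    by (rule nn_integral_bij_count_space[OF inj_on_imp_bij_betw[OF b_inj]])
  also have "\<dots> \<le> energy \<pi> ?\<nu>"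
    unfolding energy_def
    by (subst nn_integral_count_space_indicator) (auto intro!: nn_integral_mono simp: indicator_def)
  \<comment> \<open>The sum of a constant over all \<open>n\<close> is that constant times
    \<open>\<infinity>\<close>; being finite, it forces the constant to vanish.\<close>
  finally have "(emeasure \<mu> ?S)\<^sup>2 * ennreal ?c * \<infinity> < \<infinity>"
    using fin by (simp add: nn_integral_const)
  then have "(emeasure \<mu> ?S)\<^sup>2 * ennreal ?c = 0"
    by (auto simp: ennreal_mult_top split: if_splits)
  then have "emeasure \<mu> ?S = 0" using \<pi>(2) by (simp add: ennreal_eq_0_iff)
  then show ?thesis using S by auto
qed



theorem lemma3p1:
  fixes \<pi> :: "('d::finite \<Rightarrow> vertex) \<Rightarrow> real"
  assumes "\<And>\<alpha>. 0 < \<pi> \<alpha>" and "0 < (INF \<alpha>. \<pi> \<alpha>)"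
  shows
    "(\<forall>\<mu> :: ('d \<Rightarrow> ctree) measure.
        sets \<mu> = sets (restrict_space polytree_borel bdry) \<longrightarrow>
        energy \<pi> (distr \<mu> polytree_borel (\<lambda>\<omega>. \<omega>)) < \<infinity> \<longrightarrow>
        (\<forall>j. \<forall>\<zeta> \<in> range End. {\<omega> \<in> bdry. \<omega> j = \<zeta>} \<in> null_sets \<mu>))
   \<and> (\<forall>p :: 'd \<Rightarrow> vertex \<Rightarrow> real.
        (\<forall>j v. 0 < p j v) \<longrightarrow> (\<forall>\<beta>. \<pi> \<beta> = (\<Prod>j\<in>UNIV. p j (\<beta> j))) \<longrightarrow>
        (\<forall>E \<in> sets polytree_borel.
           capacity \<pi> E \<le> (\<Prod>j\<in>UNIV. tree_capacity (p j) ((\<lambda>\<alpha>. \<alpha> j) ` E)) \<and>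
           (E = {\<alpha>. \<forall>j. \<alpha> j \<in> (\<lambda>\<alpha>. \<alpha> j) ` E} \<longrightarrow>
              capacity \<pi> E = (\<Prod>j\<in>UNIV. tree_capacity (p j) ((\<lambda>\<alpha>. \<alpha> j) ` E)))))
   \<and> (\<forall>E \<in> sets polytree_borel. \<forall>\<mu> :: ('d \<Rightarrow> ctree) measure.
        sets \<mu> = sets polytree_borel \<longrightarrow> energy \<pi> \<mu> < \<infinity> \<longrightarrow>
        holds_qae \<pi> E (\<lambda>\<alpha>. potential \<pi> \<mu> \<alpha> \<le> 1) \<longrightarrow>
        emeasure \<mu> E \<le> capacity \<pi> E)
   \<and> (\<forall>E \<in> sets polytree_borel. \<forall>\<mu> :: ('d \<Rightarrow> ctree) measure.
        sets \<mu> = sets polytree_borel \<longrightarrow> emeasure \<mu> UNIV < \<infinity> \<longrightarrow>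
        energy \<pi> \<mu> \<le> emeasure \<mu> E \<longrightarrow>
        emeasure \<mu> E \<le> capacity \<pi> E)"
proof (intro conjI allI ballI impI)
  fix \<mu> :: "('d \<Rightarrow> ctree) measure" and j \<zeta>
  assume "sets \<mu> = sets (restrict_space polytree_borel bdry)"
    "energy \<pi> (distr \<mu> polytree_borel (\<lambda>\<omega>. \<omega>)) < \<infinity>" "\<zeta> \<in> range End"
  then show "{\<omega> \<in> bdry. \<omega> j = \<zeta>} \<in> null_sets \<mu>"
    using slice_null[of \<pi> \<mu> j] assms by auto
next
  fix p :: "'d \<Rightarrow> vertex \<Rightarrow> real" and E :: "('d \<Rightarrow> ctree) set"
  assume "\<forall>j v. 0 < p j v" "\<forall>\<beta>. \<pi> \<beta> = (\<Prod>j\<in>UNIV. p j (\<beta> j))"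
  then have box: "capacity \<pi> {\<alpha>. \<forall>j. \<alpha> j \<in> (\<lambda>\<alpha>. \<alpha> j) ` E}
      = (\<Prod>j\<in>UNIV. tree_capacity (p j) ((\<lambda>\<alpha>. \<alpha> j) ` E))"
    by (intro capacity_box) auto
  \<comment> \<open>The upper bound is monotonicity: \<open>E\<close> lies in the box spanned by its
    projections, whose capacity is known exactly.\<close>
  have "E \<subseteq> {\<alpha>. \<forall>j. \<alpha> j \<in> (\<lambda>\<alpha>. \<alpha> j) ` E}" by auto
  then show "capacity \<pi> E \<le> (\<Prod>j\<in>UNIV. tree_capacity (p j) ((\<lambda>\<alpha>. \<alpha> j) ` E))"
    unfolding box[symmetric] by (rule capacity_mono)
  assume "E = {\<alpha>. \<forall>j. \<alpha> j \<in> (\<lambda>\<alpha>. \<alpha> j) ` E}"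
  with box show "capacity \<pi> E = (\<Prod>j\<in>UNIV. tree_capacity (p j) ((\<lambda>\<alpha>. \<alpha> j) ` E))" by simp
next
  fix E :: "('d \<Rightarrow> ctree) set" and \<mu> :: "('d \<Rightarrow> ctree) measure"
  assume "E \<in> sets polytree_borel" "sets \<mu> = sets polytree_borel" "energy \<pi> \<mu> < \<infinity>"
    "holds_qae \<pi> E (\<lambda>\<alpha>. potential \<pi> \<mu> \<alpha> \<le> 1)"
  then show "emeasure \<mu> E \<le> capacity \<pi> E"
    using assms(1) by (intro emeasure_le_capacity_of_potential_le)
next
  fix E :: "('d \<Rightarrow> ctree) set" and \<mu> :: "('d \<Rightarrow> ctree) measure"
  assume *: "sets \<mu> = sets polytree_borel" "emeasure \<mu> UNIV < \<infinity>" "energy \<pi> \<mu> \<le> emeasure \<mu> E"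
  then have "emeasure \<mu> E < \<infinity>"
    using emeasure_space[of \<mu> E] sets_eq_imp_space_eq[OF *(1)] by simp
  with * show "emeasure \<mu> E \<le> capacity \<pi> E"
    by (intro emeasure_le_capacity)
qed

end
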